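(* Let $\mathbb{k}$ be a field, $m\ge2$, and $f_1,\dots,f_m\in\mathbb{k}[x_1,\dots,x_n]$ with $\gcd(f_1,\dots,f_m)=1$. Then there exists an infinite sequence $\{h_i\}_{i\ge1}$ of elements of the ideal $(f_1,\dots,f_m)$ such that $\gcd(h_i,h_j)=1$ for all $i\ne j$. *)

theory Defs
  imports "HOL-Library.Poly_Mapping"
begin

(* Multivariate polynomials over a field 'a are represented as finitely supported
maps from monomials (exponent vectors nat \<Rightarrow>\<^sub>0 nat) to coefficients. The polynomial
ring k[x_1,...,x_n] is the subring of those polynomials only involving variables 0..n-1. *)

type_synonym 'a mpoly = "(nat \<Rightarrow>\<^sub>0 nat) \<Rightarrow>\<^sub>0 'a"

definition poly_ring :: "nat \<Rightarrow> ('a::zero) mpoly set" where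
  "poly_ring n = {p :: 'a mpoly. \<forall>t \<in> Poly_Mapping.keys p. \<forall>i \<in> Poly_Mapping.keys t. i < n}"

definition dvd_in :: "nat \<Rightarrow> ('a::comm_ring_1) mpoly \<Rightarrow> 'a mpoly \<Rightarrow> bool" where
  "dvd_in n d f \<longleftrightarrow> (\<exists>q \<in> poly_ring n. f = d * q)"

definition unit_in :: "nat \<Rightarrow> ('a::comm_ring_1) mpoly \<Rightarrow> bool" where
  "unit_in n u \<longleftrightarrow> dvd_in n u 1"

definition gcd_one_in :: "nat \<Rightarrow> ('a::comm_ring_1) mpoly set \<Rightarrow> bool" where
  "gcd_one_in n S \<longleftrightarrow> (\<forall>d \<in> poly_ring n. (\<forall>f \<in> S. dvd_in n d f) \<longrightarrow> unit_in n d)"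

definition ideal_gen :: "nat \<Rightarrow> nat \<Rightarrow> (nat \<Rightarrow> ('a::comm_ring_1) mpoly) \<Rightarrow> 'a mpoly set" where
  "ideal_gen n m f = {(\<Sum>i<m. g i * f i) | g. \<forall>i<m. g i \<in> poly_ring n}"

end

theory Submission
  imports Defs "HOL-Computational_Algebra.Polynomial" "HOL-Computational_Algebra.Factorial_Ring"
begin

(* Polynomials over a field are a UFD. Existence of irreducible factors follows from additivity of
   total degree. That irreducibles are prime follows by induction on the number of variables: reading
   k[x_0,...,x_N] as R[x_0] with R = k[x_1,...,x_N] in which irreducibles are prime, Gauss' lemma
   handles constants, and an irreducible P of positive degree is prime because a least-degree element
   of the R-span of P and A divides constant multiples of both (pseudo-division).

   Pairwise coprime h_0, h_1, ... in I = (f_1,...,f_m) are then chosen one after another: it suffices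
   to find a nonzero h in I coprime to a given nonzero x. This goes by induction on x = q x' with q
   irreducible. If q divides the element h' found for x', use h' + x' f_j with q not dividing f_j; such
   a generator exists because gcd(f_1,...,f_m) = 1. *)

section \<open>Extending term-wise maps to polynomials\<close>

lemma poly_mapping_sum_single:
  fixes p :: "('b \<Rightarrow>\<^sub>0 'c::comm_monoid_add)"
  shows "p = (\<Sum>t\<in>Poly_Mapping.keys p. Poly_Mapping.single t (Poly_Mapping.lookup p t))"
  by (rule poly_mapping_eqI) (simp add: lookup_sum lookup_single when_def in_keys_iff)

definition mpoly_lift :: "((nat \<Rightarrow>\<^sub>0 nat) \<Rightarrow> 'a::field \<Rightarrow> 'b::comm_ring_1) \<Rightarrow> 'a mpoly \<Rightarrow> 'b" where
  "mpoly_lift F p = (\<Sum>t\<in>Poly_Mapping.keys p. F t (Poly_Mapping.lookup p t))"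

locale mpoly_lift_additive =
  fixes F :: "(nat \<Rightarrow>\<^sub>0 nat) \<Rightarrow> 'a::field \<Rightarrow> 'b::comm_ring_1"
  assumes F_add: "F t (a + b) = F t a + F t b"
begin

lemma F_zero[simp]: "F t 0 = 0"
  using F_add[of t 0 0] by simp

lemma mpoly_lift_superset:
  assumes "finite K" "Poly_Mapping.keys p \<subseteq> K"
  shows "mpoly_lift F p = (\<Sum>t\<in>K. F t (Poly_Mapping.lookup p t))"
  unfolding mpoly_lift_def
  by (rule sum.mono_neutral_left) (use assms in \<open>auto simp: in_keys_iff\<close>)

lemma mpoly_lift_add: "mpoly_lift F (p + q) = mpoly_lift F p + mpoly_lift F q"
proof -
  let ?K = "Poly_Mapping.keys p \<union> Poly_Mapping.keys q"
  have "mpoly_lift F (p + q) = (\<Sum>t\<in>?K. F t (Poly_Mapping.lookup (p+q) t))"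
    by (rule mpoly_lift_superset) (use keys_add[of p q] in auto)
  also have "\<dots> = (\<Sum>t\<in>?K. F t (Poly_Mapping.lookup p t)) + (\<Sum>t\<in>?K. F t (Poly_Mapping.lookup q t))"
    by (simp add: lookup_add F_add sum.distrib)
  also have "\<dots> = mpoly_lift F p + mpoly_lift F q"
    by (subst (1 2) mpoly_lift_superset[symmetric]) auto
  finally show ?thesis .
qed

lemma mpoly_lift_zero[simp]: "mpoly_lift F 0 = 0"
  by (simp add: mpoly_lift_def)

lemma mpoly_lift_sum: "mpoly_lift F (\<Sum>i\<in>I. g i) = (\<Sum>i\<in>I. mpoly_lift F (g i))"
  by (induction I rule: infinite_finite_induct) (auto simp: mpoly_lift_add)

lemma mpoly_lift_single[simp]: "mpoly_lift F (Poly_Mapping.single s c) = F s c"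
  by (simp add: mpoly_lift_def)

lemma mpoly_lift_uminus: "mpoly_lift F (- p) = - mpoly_lift F p"
proof -
  have "mpoly_lift F p + mpoly_lift F (-p) = 0" using mpoly_lift_add[of p "-p"] by simp
  thus ?thesis by (simp add: eq_neg_iff_add_eq_0 add.commute)
qed

lemma mpoly_lift_diff: "mpoly_lift F (p - q) = mpoly_lift F p - mpoly_lift F q"
  using mpoly_lift_add[of p "-q"] mpoly_lift_uminus[of q] by simp

end

locale mpoly_lift_multiplicative = mpoly_lift_additive +
  assumes F_mult: "F (s + t) (a * b) = F s a * F t b"
    and F_one: "F 0 1 = 1"
begin

lemma mpoly_lift_mult: "mpoly_lift F (p * q) = mpoly_lift F p * mpoly_lift F q"
proof -
  let ?lp = "Poly_Mapping.lookup p" and ?lq = "Poly_Mapping.lookup q"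
  have "p * q = (\<Sum>s\<in>Poly_Mapping.keys p. Poly_Mapping.single s (?lp s)) *
                (\<Sum>t\<in>Poly_Mapping.keys q. Poly_Mapping.single t (?lq t))"
    by (subst (1) poly_mapping_sum_single[of p], subst (1) poly_mapping_sum_single[of q]) (rule refl)
  also have "\<dots> = (\<Sum>s\<in>Poly_Mapping.keys p. \<Sum>t\<in>Poly_Mapping.keys q.
                     Poly_Mapping.single (s + t) (?lp s * ?lq t))"
    by (simp add: sum_distrib_left sum_distrib_right mult_single, subst sum.swap, rule refl)
  finally have "mpoly_lift F (p * q) = (\<Sum>s\<in>Poly_Mapping.keys p. \<Sum>t\<in>Poly_Mapping.keys q.
                     F s (?lp s) * F t (?lq t))"
    by (simp add: mpoly_lift_sum F_mult)
  also have "\<dots> = mpoly_lift F p * mpoly_lift F q"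
    by (simp add: mpoly_lift_def sum_distrib_left sum_distrib_right, subst sum.swap, rule refl)
  finally show ?thesis .
qed

lemma mpoly_lift_one: "mpoly_lift F 1 = F 0 1"
proof -
  have "(1::'a mpoly) = Poly_Mapping.single 0 1" by simp
  then show ?thesis by (metis mpoly_lift_single)
qed

end

section \<open>Weighted and total degree\<close>

(* Grouping the terms of p by the weight w t of their monomials; for an additive weight this is a ring
   homomorphism into univariate polynomials, so weighted degrees add up under multiplication. *)
definition weight_grading :: "((nat \<Rightarrow>\<^sub>0 nat) \<Rightarrow> nat) \<Rightarrow> 'a::field mpoly \<Rightarrow> 'a mpoly poly" where
  "weight_grading w = mpoly_lift (\<lambda>t c. monom (Poly_Mapping.single t c) (w t))"

definition weighted_degree :: "((nat \<Rightarrow>\<^sub>0 nat) \<Rightarrow> nat) \<Rightarrow> 'a::field mpoly \<Rightarrow> nat" where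
  "weighted_degree w p = degree (weight_grading w p)"

lemma weight_grading_multiplicative:
  assumes "\<And>s t. w (s + t) = w s + w t"
  shows "mpoly_lift_multiplicative (\<lambda>t c. monom (Poly_Mapping.single t (c::'a::field)) (w t))"
proof -
  have w0: "w 0 = 0" using assms[of 0 0] by simp
  show ?thesis
    by unfold_locales
      (simp_all add: single_add add_monom mult_monom mult_single assms w0 one_pCons monom_0)
qed

lemma coeff_weight_grading: "coeff (weight_grading w p) k =
   (\<Sum>t\<in>Poly_Mapping.keys p. if w t = k then Poly_Mapping.single t (Poly_Mapping.lookup p t) else 0)"
  by (simp add: weight_grading_def mpoly_lift_def coeff_sum)

lemma lookup_coeff_weight_grading: "Poly_Mapping.lookup (coeff (weight_grading w p) (w t0)) t0 = Poly_Mapping.lookup p t0"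
proof -
  have "Poly_Mapping.lookup (coeff (weight_grading w p) (w t0)) t0 =
     (\<Sum>t\<in>Poly_Mapping.keys p. if t = t0 then Poly_Mapping.lookup p t else 0)"
    unfolding coeff_weight_grading lookup_sum
    by (rule sum.cong) (auto simp: lookup_single when_def)
  also have "\<dots> = Poly_Mapping.lookup p t0"
    by (simp add: in_keys_iff)
  finally show ?thesis .
qed

lemma weight_grading_eq_0_iff: "weight_grading w p = 0 \<longleftrightarrow> p = 0"
proof
  assume "weight_grading w p = 0"
  then have "Poly_Mapping.lookup p t = 0" for t
    using lookup_coeff_weight_grading[of w p t] by simp
  then show "p = 0" by (intro poly_mapping_eqI) simp
qed (simp add: weight_grading_def mpoly_lift_def)

lemma weighted_degree_ge: "t \<in> Poly_Mapping.keys p \<Longrightarrow> w t \<le> weighted_degree w p"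
  unfolding weighted_degree_def
  by (rule le_degree) (metis in_keys_iff lookup_coeff_weight_grading lookup_zero)

lemma weighted_degree_le:
  assumes H: "\<And>t. t \<in> Poly_Mapping.keys p \<Longrightarrow> w t \<le> k"
  shows "weighted_degree w p \<le> k"
  unfolding weighted_degree_def
proof (rule degree_le, intro allI impI)
  fix i assume "k < i"
  have "(if w t = i then Poly_Mapping.single t (Poly_Mapping.lookup p t) else 0) = 0"
    if "t \<in> Poly_Mapping.keys p" for t
    using H[OF that] \<open>k < i\<close> by auto
  then show "coeff (weight_grading w p) i = 0"
    unfolding coeff_weight_grading by (intro sum.neutral) blast
qed

lemma weighted_degree_eq_0_iff: "weighted_degree w p = 0 \<longleftrightarrow> (\<forall>t\<in>Poly_Mapping.keys p. w t = 0)"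
  using weighted_degree_ge[of _ p w] weighted_degree_le[of p w 0] by fastforce

lemma weighted_degree_mult:
  assumes "\<And>s t. w (s + t) = w s + w t" "p \<noteq> 0" "q \<noteq> 0"
  shows "weighted_degree w (p * q) = weighted_degree w p + weighted_degree w q"
proof -
  interpret mpoly_lift_multiplicative "(\<lambda>t c. monom (Poly_Mapping.single t (c::'a::field)) (w t))"
    by (rule weight_grading_multiplicative) (rule assms(1))
  show ?thesis
    unfolding weighted_degree_def weight_grading_def mpoly_lift_mult
    by (rule degree_mult_eq) (use assms(2,3) weight_grading_eq_0_iff[unfolded weight_grading_def] in auto)
qed

definition monom_degree :: "(nat \<Rightarrow>\<^sub>0 nat) \<Rightarrow> nat" where
  "monom_degree t = (\<Sum>i\<in>Poly_Mapping.keys t. Poly_Mapping.lookup t i)"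

lemma monom_degree_superset: "finite K \<Longrightarrow> Poly_Mapping.keys t \<subseteq> K \<Longrightarrow> monom_degree t = (\<Sum>i\<in>K. Poly_Mapping.lookup t i)"
  unfolding monom_degree_def by (rule sum.mono_neutral_left) (auto simp: in_keys_iff)

lemma monom_degree_add: "monom_degree (s + t) = monom_degree s + monom_degree t"
proof -
  let ?K = "Poly_Mapping.keys s \<union> Poly_Mapping.keys t"
  have "monom_degree (s + t) = (\<Sum>i\<in>?K. Poly_Mapping.lookup (s+t) i)"
    by (rule monom_degree_superset) (use keys_add[of s t] in auto)
  also have "\<dots> = (\<Sum>i\<in>?K. Poly_Mapping.lookup s i) + (\<Sum>i\<in>?K. Poly_Mapping.lookup t i)"
    by (simp add: lookup_add sum.distrib)
  also have "\<dots> = monom_degree s + monom_degree t"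
    by (subst (1 2) monom_degree_superset) auto
  finally show ?thesis .
qed

lemma monom_degree_eq_0_iff: "monom_degree t = 0 \<longleftrightarrow> t = 0"
proof
  assume "monom_degree t = 0"
  then have "\<forall>i\<in>Poly_Mapping.keys t. Poly_Mapping.lookup t i = 0"
    unfolding monom_degree_def by simp
  then show "t = 0" by (intro poly_mapping_eqI) (auto simp: in_keys_iff)
qed (simp add: monom_degree_def)

abbreviation total_degree :: "'a::field mpoly \<Rightarrow> nat" where "total_degree \<equiv> weighted_degree monom_degree"

lemma mpoly_eq_const: "Poly_Mapping.keys (p::'a::field mpoly) \<subseteq> {0} \<Longrightarrow> p = Poly_Mapping.single 0 (Poly_Mapping.lookup p 0)"
  by (intro poly_mapping_eqI) (auto simp: lookup_single when_def in_keys_iff)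

lemma total_degree_eq_0_iff: "total_degree p = 0 \<longleftrightarrow> p = Poly_Mapping.single 0 (Poly_Mapping.lookup p 0)"
proof
  assume "total_degree p = 0"
  then have "Poly_Mapping.keys p \<subseteq> {0}" by (auto simp: weighted_degree_eq_0_iff monom_degree_eq_0_iff)
  then show "p = Poly_Mapping.single 0 (Poly_Mapping.lookup p 0)" by (rule mpoly_eq_const)
next
  assume H: "p = Poly_Mapping.single 0 (Poly_Mapping.lookup p 0)"
  have "total_degree (Poly_Mapping.single 0 (Poly_Mapping.lookup p 0)) = 0"
    by (auto simp: weighted_degree_eq_0_iff monom_degree_def)
  then show "total_degree p = 0" by (subst H)
qed

lemma is_unit_const_mpoly:
  fixes c :: "'a::field"
  assumes "c \<noteq> 0" shows "Poly_Mapping.single (0::nat\<Rightarrow>\<^sub>0nat) c dvd 1"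
proof -
  have "Poly_Mapping.single 0 c * Poly_Mapping.single 0 (inverse c) = (1 :: 'a mpoly)"
    using assms by (simp add: mult_single)
  then show ?thesis by (rule dvdI[OF sym])
qed

lemma mpoly_is_unit_iff:
  fixes p :: "'a::field mpoly"
  shows "p dvd 1 \<longleftrightarrow> p \<noteq> 0 \<and> total_degree p = 0"
proof
  assume u: "p dvd 1"
  then obtain q where pq0: "1 = p * q" by (rule dvdE)
  then have pq: "p * q = 1" by (rule sym)
  have "p \<noteq> 0" using pq by (metis mult_zero_left zero_neq_one)
  have "q \<noteq> 0" using pq by (metis mult_zero_right zero_neq_one)
  have "total_degree (p * q) = total_degree p + total_degree q" using \<open>p \<noteq> 0\<close> \<open>q \<noteq> 0\<close> by (intro weighted_degree_mult monom_degree_add)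
  moreover have "total_degree (1::'a mpoly) = 0" by (simp add: weighted_degree_eq_0_iff monom_degree_def)
  ultimately have "total_degree p = 0" unfolding pq by linarith
  then show "p \<noteq> 0 \<and> total_degree p = 0" using \<open>p \<noteq> 0\<close> by blast
next
  assume "p \<noteq> 0 \<and> total_degree p = 0"
  then have H: "p = Poly_Mapping.single 0 (Poly_Mapping.lookup p 0)" "p \<noteq> 0"
    using total_degree_eq_0_iff[of p] by blast+
  have "Poly_Mapping.lookup p 0 \<noteq> 0"
  proof
    assume Z: "Poly_Mapping.lookup p 0 = 0"
    have "Poly_Mapping.single (0::nat\<Rightarrow>\<^sub>0nat) (Poly_Mapping.lookup p 0) = 0" using Z by simp
    with H(1) have "p = 0" by (rule trans)
    with H(2) show False by contradiction
  qed
  then have "Poly_Mapping.single (0::nat\<Rightarrow>\<^sub>0nat) (Poly_Mapping.lookup p 0) dvd 1" by (rule is_unit_const_mpoly)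
  then show "p dvd 1" by (subst H(1))
qed

lemma total_degree_mult: "p \<noteq> 0 \<Longrightarrow> q \<noteq> 0 \<Longrightarrow> total_degree (p * q) = total_degree p + total_degree q"
  by (intro weighted_degree_mult monom_degree_add)

lemma total_degree_less_mult:
  fixes a b :: "'a::field mpoly"
  assumes "a * b \<noteq> 0" "\<not> a dvd 1"
  shows "total_degree b < total_degree (a * b)"
proof -
  have "a \<noteq> 0" "b \<noteq> 0" using assms by auto
  have "\<not> (a \<noteq> 0 \<and> total_degree a = 0)" using assms(2) mpoly_is_unit_iff[of a] by blast
  then have "total_degree a > 0" using \<open>a \<noteq> 0\<close> by simp
  then show ?thesis using total_degree_mult[OF \<open>a \<noteq> 0\<close> \<open>b \<noteq> 0\<close>] by simp
qed

lemma poly_ring_iff: "p \<in> poly_ring n \<longleftrightarrow> (\<forall>t\<in>Poly_Mapping.keys p. \<forall>i\<in>Poly_Mapping.keys t. i < n)"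
  by (simp add: poly_ring_def)

lemma poly_ring_add: "p \<in> poly_ring n \<Longrightarrow> q \<in> poly_ring n \<Longrightarrow> p + q \<in> poly_ring n"
  using keys_add[of p q] unfolding poly_ring_iff by blast

lemma poly_ring_diff: "(p::'a::field mpoly) \<in> poly_ring n \<Longrightarrow> q \<in> poly_ring n \<Longrightarrow> p - q \<in> poly_ring n"
  using keys_diff[of p q] unfolding poly_ring_iff by blast

lemma poly_ring_zero: "0 \<in> poly_ring n"
  unfolding poly_ring_iff by simp

lemma poly_ring_one: "(1::'a::field mpoly) \<in> poly_ring n"
  unfolding poly_ring_iff by simp

lemma poly_ring_mult: "(p::'a::field mpoly) \<in> poly_ring n \<Longrightarrow> q \<in> poly_ring n \<Longrightarrow> p * q \<in> poly_ring n"
  unfolding poly_ring_iff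
proof (intro ballI)
  fix t i assume p: "\<forall>t\<in>Poly_Mapping.keys p. \<forall>i\<in>Poly_Mapping.keys t. i < n"
    and q: "\<forall>t\<in>Poly_Mapping.keys q. \<forall>i\<in>Poly_Mapping.keys t. i < n"
    and t: "t \<in> Poly_Mapping.keys (p * q)" and i: "i \<in> Poly_Mapping.keys t"
  from t keys_mult[of p q] obtain a b where ab: "t = a + b" "a \<in> Poly_Mapping.keys p" "b \<in> Poly_Mapping.keys q"
    by blast
  with i keys_add[of a b] have "i \<in> Poly_Mapping.keys a \<or> i \<in> Poly_Mapping.keys b" by blast
  then show "i < n" using p q ab by blast
qed

lemma poly_ring_sum: "(\<And>i. i \<in> I \<Longrightarrow> g i \<in> poly_ring n) \<Longrightarrow> (\<Sum>i\<in>I. g i) \<in> poly_ring n"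
  by (induction I rule: infinite_finite_induct) (auto intro: poly_ring_add poly_ring_zero)

lemma poly_ring_mono: "p \<in> poly_ring n \<Longrightarrow> n \<le> m \<Longrightarrow> p \<in> poly_ring m"
  unfolding poly_ring_iff by force

lemma poly_ring_exists: "\<exists>n. p \<in> poly_ring n"
proof -
  let ?n = "Suc (Max (\<Union>t\<in>Poly_Mapping.keys p. Poly_Mapping.keys t))"
  have "finite (\<Union>t\<in>Poly_Mapping.keys p. Poly_Mapping.keys t)" by simp
  then have "p \<in> poly_ring ?n" unfolding poly_ring_iff
    by (auto simp: less_Suc_eq_le intro!: Max_ge)
  then show ?thesis ..
qed

lemma poly_ring_power: "(c::'a::field mpoly) \<in> poly_ring N \<Longrightarrow> c ^ k \<in> poly_ring N"
  by (induction k) (auto intro: poly_ring_mult poly_ring_one)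

lemma poly_ring_prod_list: "set xs \<subseteq> poly_ring n \<Longrightarrow> prod_list (xs :: 'a::field mpoly list) \<in> poly_ring n"
  by (induction xs) (auto intro: poly_ring_mult poly_ring_one)

lemma poly_ring_factor:
  fixes p q :: "'a::field mpoly"
  assumes "p * q \<in> poly_ring n" "p * q \<noteq> 0"
  shows "p \<in> poly_ring n"
  unfolding poly_ring_def mem_Collect_eq
proof (intro ballI)
  fix t i assume t: "t \<in> Poly_Mapping.keys p" and i: "i \<in> Poly_Mapping.keys t"
  show "i < n"
  proof (rule ccontr)
    assume "\<not> i < n"
    let ?w = "\<lambda>t. Poly_Mapping.lookup t i"
    have wa: "\<And>s t. ?w (s + t) = ?w s + ?w t" by (simp add: lookup_add)
    have Z: "weighted_degree ?w (p * q) = 0"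
      unfolding weighted_degree_eq_0_iff
    proof
      fix s assume "s \<in> Poly_Mapping.keys (p * q)"
      then have "\<forall>i\<in>Poly_Mapping.keys s. i < n" using assms(1) unfolding poly_ring_def by blast
      then have "i \<notin> Poly_Mapping.keys s" using \<open>\<not> i < n\<close> by blast
      then show "Poly_Mapping.lookup s i = 0" by (simp add: in_keys_iff)
    qed
    have "p \<noteq> 0" "q \<noteq> 0" using assms(2) by auto
    moreover note weighted_degree_mult[of ?w p q, OF wa this]
    ultimately have "weighted_degree ?w p = 0" using Z by simp
    then show False using t i by (auto simp: weighted_degree_eq_0_iff in_keys_iff)
  qed
qed

section \<open>The first variable as polynomial variable\<close>

lift_definition monom_tail :: "(nat \<Rightarrow>\<^sub>0 nat) \<Rightarrow> (nat \<Rightarrow>\<^sub>0 nat)" is "\<lambda>f i. f (Suc i)"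
proof -
  fix f :: "nat \<Rightarrow> nat" assume "finite {x. f x \<noteq> 0}"
  then have "finite (Suc -` {x. f x \<noteq> 0})" by (rule finite_vimageI) simp
  then show "finite {x. f (Suc x) \<noteq> 0}" by (simp add: vimage_def)
qed

lift_definition monom_shift :: "(nat \<Rightarrow>\<^sub>0 nat) \<Rightarrow> (nat \<Rightarrow>\<^sub>0 nat)" is "\<lambda>f i. if i = 0 then 0 else f (i - 1)"
proof -
  fix f :: "nat \<Rightarrow> nat" assume "finite {x. f x \<noteq> 0}"
  then have "finite (Suc ` {x. f x \<noteq> 0})" by simp
  moreover have "{x. (if x = 0 then 0 else f (x - 1)) \<noteq> 0} \<subseteq> Suc ` {x. f x \<noteq> 0}"
  proof
    fix x assume "x \<in> {x. (if x = 0 then 0 else f (x - 1)) \<noteq> 0}"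
    then have "x \<noteq> 0" "f (x - 1) \<noteq> 0" by (auto split: if_splits)
    then have "x = Suc (x - 1)" "x - 1 \<in> {x. f x \<noteq> 0}" by auto
    then show "x \<in> Suc ` {x. f x \<noteq> 0}" by (rule image_eqI)
  qed
  ultimately show "finite {x. (if x = 0 then 0 else f (x - 1)) \<noteq> 0}" by (rule finite_subset[rotated])
qed

lemma lookup_monom_tail[simp]: "Poly_Mapping.lookup (monom_tail t) i = Poly_Mapping.lookup t (Suc i)"
  by transfer simp

lemma lookup_monom_shift: "Poly_Mapping.lookup (monom_shift t) i = (if i = 0 then 0 else Poly_Mapping.lookup t (i - 1))"
  by transfer simp

lemma monom_tail_add: "monom_tail (s + t) = monom_tail s + monom_tail t"
  by (rule poly_mapping_eqI) (simp add: lookup_add)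

lemma monom_tail_zero[simp]: "monom_tail 0 = 0"
  by (rule poly_mapping_eqI) simp

lemma monom_eq_iff: "s = t \<longleftrightarrow> Poly_Mapping.lookup s 0 = Poly_Mapping.lookup t 0 \<and> monom_tail s = monom_tail t"
proof
  assume "Poly_Mapping.lookup s 0 = Poly_Mapping.lookup t 0 \<and> monom_tail s = monom_tail t"
  then have H: "Poly_Mapping.lookup s 0 = Poly_Mapping.lookup t 0" "monom_tail s = monom_tail t" by auto
  have "Poly_Mapping.lookup s i = Poly_Mapping.lookup t i" for i
  proof (cases i)
    case (Suc j)
    have "Poly_Mapping.lookup (monom_tail s) j = Poly_Mapping.lookup (monom_tail t) j" using H(2) by simp
    then show ?thesis using Suc by simp
  qed (use H in simp)
  then show "s = t" by (rule poly_mapping_eqI)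
qed simp

lemma monom_tail_shift: "monom_tail (monom_shift s + Poly_Mapping.single 0 i) = s"
  by (rule poly_mapping_eqI) (simp add: lookup_add lookup_monom_shift lookup_single)

lemma lookup_monom_shift_0: "Poly_Mapping.lookup (monom_shift s + Poly_Mapping.single 0 i) 0 = i"
  by (simp add: lookup_add lookup_monom_shift)

(* Reading a polynomial in x_0, x_1, ... as a univariate polynomial in x_0 whose coefficients are
   polynomials in the remaining variables, renamed x_(i+1) to x_i. *)
definition upoly_term :: "(nat \<Rightarrow>\<^sub>0 nat) \<Rightarrow> 'a::field \<Rightarrow> 'a mpoly poly" where
  "upoly_term t c = monom (Poly_Mapping.single (monom_tail t) c) (Poly_Mapping.lookup t 0)"

definition to_upoly :: "'a::field mpoly \<Rightarrow> 'a mpoly poly" where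
  "to_upoly = mpoly_lift upoly_term"

interpretation to_upoly_hom: mpoly_lift_multiplicative upoly_term
  by unfold_locales
    (simp_all add: upoly_term_def single_add add_monom mult_monom mult_single monom_tail_add lookup_add one_pCons monom_0)

lemma to_upoly_mult: "to_upoly (p * q) = to_upoly p * to_upoly q" by (simp add: to_upoly_def to_upoly_hom.mpoly_lift_mult)
lemma to_upoly_one: "to_upoly 1 = 1" by (simp add: to_upoly_def to_upoly_hom.mpoly_lift_one to_upoly_hom.F_one)
lemma to_upoly_zero: "to_upoly 0 = 0" by (simp add: to_upoly_def)
lemma to_upoly_diff: "to_upoly (p - q) = to_upoly p - to_upoly q" by (simp add: to_upoly_def to_upoly_hom.mpoly_lift_diff)

lemma coeff_to_upoly: "coeff (to_upoly p) k =
   (\<Sum>t\<in>Poly_Mapping.keys p. if Poly_Mapping.lookup t 0 = k then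
        Poly_Mapping.single (monom_tail t) (Poly_Mapping.lookup p t) else 0)"
  by (simp add: to_upoly_def mpoly_lift_def upoly_term_def coeff_sum)

lemma lookup_coeff_to_upoly: "Poly_Mapping.lookup (coeff (to_upoly p) (Poly_Mapping.lookup t0 0)) (monom_tail t0) =
     Poly_Mapping.lookup p t0"
proof -
  have "Poly_Mapping.lookup (coeff (to_upoly p) (Poly_Mapping.lookup t0 0)) (monom_tail t0) =
     (\<Sum>t\<in>Poly_Mapping.keys p. if t = t0 then Poly_Mapping.lookup p t else 0)"
    unfolding coeff_to_upoly lookup_sum
    by (rule sum.cong) (auto simp: lookup_single when_def monom_eq_iff[of _ t0])
  also have "\<dots> = Poly_Mapping.lookup p t0"
    by (simp add: in_keys_iff)
  finally show ?thesis .
qed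

lemma to_upoly_eq_0_iff: "to_upoly p = 0 \<longleftrightarrow> p = 0"
proof
  assume "to_upoly p = 0"
  then have "Poly_Mapping.lookup p t = 0" for t
    using lookup_coeff_to_upoly[of p t] by simp
  then show "p = 0" by (intro poly_mapping_eqI) simp
qed (simp add: to_upoly_zero)

lemma to_upoly_inj: "to_upoly p = to_upoly q \<Longrightarrow> p = q"
  using to_upoly_eq_0_iff[of "p - q"] by (simp add: to_upoly_diff)

lemma to_upoly_single: "to_upoly (Poly_Mapping.single (monom_shift s + Poly_Mapping.single 0 i) c) = monom (Poly_Mapping.single s c) i"
  by (simp add: to_upoly_def upoly_term_def monom_tail_shift lookup_monom_shift_0)

definition of_upoly :: "'a::field mpoly poly \<Rightarrow> 'a mpoly" where
  "of_upoly P = (\<Sum>i\<le>degree P. \<Sum>s\<in>Poly_Mapping.keys (coeff P i).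
      Poly_Mapping.single (monom_shift s + Poly_Mapping.single 0 i) (Poly_Mapping.lookup (coeff P i) s))"

lemma to_upoly_of_upoly[simp]: "to_upoly (of_upoly P) = P"
proof -
  define g where "g i s = Poly_Mapping.single (monom_shift s + Poly_Mapping.single 0 i) (Poly_Mapping.lookup (coeff P i) s)" for i s
  have "P = (\<Sum>i\<le>degree P. monom (coeff P i) i)" by (simp add: poly_as_sum_of_monoms)
  also have "\<dots> = (\<Sum>i\<le>degree P. \<Sum>s\<in>Poly_Mapping.keys (coeff P i).
        monom (Poly_Mapping.single s (Poly_Mapping.lookup (coeff P i) s)) i)"
    by (subst (1) poly_mapping_sum_single[of "coeff P _"]) (simp add: monom_sum)
  also have "\<dots> = (\<Sum>i\<le>degree P. \<Sum>s\<in>Poly_Mapping.keys (coeff P i). to_upoly (g i s))"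
    by (simp add: g_def to_upoly_single)
  also have "\<dots> = to_upoly (\<Sum>i\<le>degree P. \<Sum>s\<in>Poly_Mapping.keys (coeff P i). g i s)"
    unfolding to_upoly_def by (simp add: to_upoly_hom.mpoly_lift_sum)
  also have "\<dots> = to_upoly (of_upoly P)" by (simp add: of_upoly_def g_def)
  finally show ?thesis by (rule sym)
qed

lemma of_upoly_poly_ring:
  assumes "\<And>i. coeff P i \<in> poly_ring N"
  shows "of_upoly P \<in> poly_ring (Suc N)"
  unfolding of_upoly_def
proof (intro poly_ring_sum)
  fix i s assume s: "s \<in> Poly_Mapping.keys (coeff P i)"
  have "j < Suc N" if j: "j \<in> Poly_Mapping.keys (monom_shift s + Poly_Mapping.single 0 i)" for j
  proof (cases j)
    case (Suc j')
    with j keys_add[of "monom_shift s" "Poly_Mapping.single 0 i"] have "j \<in> Poly_Mapping.keys (monom_shift s)"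
      by (auto split: if_splits)
    then have "j' \<in> Poly_Mapping.keys s" using Suc by (simp add: in_keys_iff lookup_monom_shift)
    then show ?thesis using assms[of i] s Suc unfolding poly_ring_iff by auto
  qed simp
  then show "Poly_Mapping.single (monom_shift s + Poly_Mapping.single 0 i) (Poly_Mapping.lookup (coeff P i) s) \<in> poly_ring (Suc N)"
    unfolding poly_ring_iff by simp
qed

lemma of_upoly_mult: "of_upoly (A * B) = of_upoly A * of_upoly B"
  by (rule to_upoly_inj) (simp add: to_upoly_mult)

lemma to_upoly_dvd_iff: "to_upoly a dvd to_upoly b \<longleftrightarrow> a dvd b"
proof
  assume "to_upoly a dvd to_upoly b"
  then obtain C where "to_upoly b = to_upoly a * C" by (rule dvdE)
  then have "to_upoly b = to_upoly (a * of_upoly C)" by (simp add: to_upoly_mult)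
  then have "b = a * of_upoly C" by (rule to_upoly_inj)
  then show "a dvd b" by (rule dvdI)
next
  assume "a dvd b"
  then obtain c where "b = a * c" by (rule dvdE)
  then show "to_upoly a dvd to_upoly b" by (simp add: to_upoly_mult)
qed

lemma to_upoly_unit_iff: "to_upoly a dvd 1 \<longleftrightarrow> a dvd 1"
  using to_upoly_dvd_iff[of a 1] by (simp add: to_upoly_one)

lemma to_upoly_irreducible_iff: "irreducible (to_upoly p) \<longleftrightarrow> irreducible p"
proof
  assume H: "irreducible (to_upoly p)"
  show "irreducible p"
  proof (rule irreducibleI)
    show "p \<noteq> 0" using H by (auto simp: to_upoly_zero)
    show "\<not> p dvd 1" using H by (auto simp: to_upoly_unit_iff dest: irreducible_not_unit)
    fix a b assume "p = a * b"
    then have "to_upoly p = to_upoly a * to_upoly b" by (simp add: to_upoly_mult)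
    then show "a dvd 1 \<or> b dvd 1" using H by (auto dest: irreducibleD simp: to_upoly_unit_iff)
  qed
next
  assume H: "irreducible p"
  show "irreducible (to_upoly p)"
  proof (rule irreducibleI)
    show "to_upoly p \<noteq> 0" using H by (auto simp: to_upoly_eq_0_iff)
    show "\<not> to_upoly p dvd 1" using H by (auto simp: to_upoly_unit_iff dest: irreducible_not_unit)
    fix A B assume "to_upoly p = A * B"
    then have "to_upoly p = to_upoly (of_upoly A * of_upoly B)" by (simp add: to_upoly_mult)
    then have "p = of_upoly A * of_upoly B" by (rule to_upoly_inj)
    then have "of_upoly A dvd 1 \<or> of_upoly B dvd 1" using H by (auto dest: irreducibleD)
    then show "A dvd 1 \<or> B dvd 1" using to_upoly_unit_iff[of "of_upoly A"] to_upoly_unit_iff[of "of_upoly B"] by simp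
  qed
qed

lemma coeff_to_upoly_poly_ring:
  assumes "p \<in> poly_ring (Suc N)"
  shows "coeff (to_upoly p) k \<in> poly_ring N"
  unfolding coeff_to_upoly
proof (rule poly_ring_sum)
  fix t assume t: "t \<in> Poly_Mapping.keys p"
  have "Poly_Mapping.single (monom_tail t) c \<in> poly_ring N" for c :: 'a
  proof -
    have "i < N" if "i \<in> Poly_Mapping.keys (monom_tail t)" for i
    proof -
      have "Suc i \<in> Poly_Mapping.keys t" using that by (simp add: in_keys_iff)
      then show ?thesis using assms t unfolding poly_ring_iff by fastforce
    qed
    then show ?thesis unfolding poly_ring_iff by simp
  qed
  then show "(if Poly_Mapping.lookup t 0 = k then Poly_Mapping.single (monom_tail t) (Poly_Mapping.lookup p t) else 0) \<in> poly_ring N"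
    by (simp add: poly_ring_zero)
qed

lemma irreducible_divisor_by_measure:
  fixes f :: "'b::{comm_semiring_1,semiring_no_zero_divisors} \<Rightarrow> nat" and x :: 'b
  assumes f: "\<And>a b. a * b \<noteq> 0 \<Longrightarrow> \<not> a dvd 1 \<Longrightarrow> f b < f (a * b)"
  shows "x \<noteq> 0 \<Longrightarrow> \<not> x dvd 1 \<Longrightarrow> \<exists>q. irreducible q \<and> q dvd x"
proof (induction x rule: measure_induct_rule[where f=f])
  case (less x)
  show ?case
  proof (cases "irreducible x")
    case True then show ?thesis by (blast intro: dvd_refl)
  next
    case False
    then obtain a b where ab: "x = a * b" "\<not> a dvd 1" "\<not> b dvd 1"
      using less.prems unfolding irreducible_def by blast
    have "a \<noteq> 0" using ab less.prems by auto
    have "f a < f x" using f[of b a] ab less.prems by (simp add: mult.commute)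
    then obtain q where "irreducible q" "q dvd a" using less.IH[of a] \<open>a \<noteq> 0\<close> ab by blast
    then show ?thesis using ab(1) by (auto intro: dvd_mult2)
  qed
qed

lemma mpoly_irreducible_divisor:
  fixes x :: "'a::field mpoly"
  shows "x \<noteq> 0 \<Longrightarrow> \<not> x dvd 1 \<Longrightarrow> \<exists>q. irreducible q \<and> q dvd x"
  by (rule irreducible_divisor_by_measure[of total_degree]) (rule total_degree_less_mult)

abbreviation upoly_size :: "'a::field mpoly poly \<Rightarrow> nat" where "upoly_size P \<equiv> total_degree (of_upoly P)"

lemma upoly_size_less_mult:
  fixes A B :: "'a::field mpoly poly"
  assumes "A * B \<noteq> 0" "\<not> A dvd 1"
  shows "upoly_size B < upoly_size (A * B)"
proof -
  have "of_upoly A * of_upoly B \<noteq> 0" using assms(1) to_upoly_of_upoly[of "A * B"] by (metis of_upoly_mult to_upoly_zero)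
  moreover have "\<not> of_upoly A dvd 1" using assms(2) to_upoly_unit_iff[of "of_upoly A"] by simp
  ultimately show ?thesis unfolding of_upoly_mult by (rule total_degree_less_mult)
qed

lemma upoly_irreducible_divisor:
  fixes g :: "'a::field mpoly poly"
  shows "degree g > 0 \<Longrightarrow> \<exists>h. irreducible h \<and> degree h > 0 \<and> h dvd g"
proof (induction g rule: measure_induct_rule[where f=upoly_size])
  case (less g)
  show ?case
  proof (cases "irreducible g")
    case True then show ?thesis using less.prems by (blast intro: dvd_refl)
  next
    case False
    have "g \<noteq> 0" using less.prems by auto
    have "\<not> g dvd 1" using less.prems by (auto simp: is_unit_poly_iff)
    then obtain a b where ab: "g = a * b" "\<not> a dvd 1" "\<not> b dvd 1"
      using False \<open>g \<noteq> 0\<close> unfolding irreducible_def by blast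
    have "a \<noteq> 0" "b \<noteq> 0" using ab \<open>g \<noteq> 0\<close> by auto
    then have dg: "degree g = degree a + degree b" using ab(1) by (simp add: degree_mult_eq)
    show ?thesis
    proof (cases "degree a > 0")
      case True
      have "upoly_size a < upoly_size g" using upoly_size_less_mult[of b a] ab \<open>g \<noteq> 0\<close> by (simp add: mult.commute)
      then obtain h where "irreducible h" "degree h > 0" "h dvd a" using less.IH[of a] True by blast
      then show ?thesis using ab(1) by (auto intro: dvd_mult2)
    next
      case False
      then have "degree b > 0" using dg less.prems by simp
      have "upoly_size b < upoly_size g" using upoly_size_less_mult[of a b] ab \<open>g \<noteq> 0\<close> by simp
      then obtain h where "irreducible h" "degree h > 0" "h dvd b" using less.IH[of b] \<open>degree b > 0\<close> by blast
      then show ?thesis using ab(1) by (auto intro: dvd_mult)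
    qed
  qed
qed

lemma irreducible_dvd_nonunit_imp_dvd:
  fixes q r :: "'a::comm_semiring_1"
  assumes "irreducible q" "r dvd q" "\<not> r dvd 1"
  shows "q dvd r"
proof -
  obtain w where w: "q = r * w" using assms(2) by (rule dvdE)
  then have "w dvd 1" using assms(1,3) irreducibleD by blast
  then obtain v where "w * v = 1" by (metis dvdE)
  then have "r = q * v" using w by (metis mult.assoc mult_1_right)
  then show ?thesis by (rule dvdI)
qed

lemma irreducible_not_const_dvd:
  fixes H :: "'b::{comm_semiring_1,semiring_no_zero_divisors} poly"
  assumes "irreducible H" "degree H > 0" "\<not> q dvd 1"
  shows "\<not> [:q:] dvd H"
proof
  assume "[:q:] dvd H"
  then obtain W where W: "H = [:q:] * W" by (rule dvdE)
  have "[:q:] dvd 1 \<or> W dvd 1" using assms(1) W by (rule irreducibleD)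
  then show False
  proof
    assume "[:q:] dvd 1" then show False using assms(3) by (simp add: is_unit_const_poly_iff)
  next
    assume "W dvd 1"
    then obtain w where "W = [:w:]" by (auto simp: is_unit_poly_iff)
    then have "degree H = 0" using W by simp
    then show False using assms(2) by simp
  qed
qed

section \<open>Irreducible polynomials are prime\<close>

definition upoly_in :: "nat \<Rightarrow> 'a::field mpoly poly \<Rightarrow> bool" where
  "upoly_in N P \<longleftrightarrow> (\<forall>i. coeff P i \<in> poly_ring N)"

lemma upoly_in_add: "upoly_in N A \<Longrightarrow> upoly_in N B \<Longrightarrow> upoly_in N (A + B)"
  by (simp add: upoly_in_def poly_ring_add)

lemma upoly_in_diff: "upoly_in N A \<Longrightarrow> upoly_in N B \<Longrightarrow> upoly_in N (A - B)"
  by (simp add: upoly_in_def poly_ring_diff)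

lemma upoly_in_zero: "upoly_in N 0"
  by (simp add: upoly_in_def poly_ring_zero)

lemma upoly_in_const: "c \<in> poly_ring N \<Longrightarrow> upoly_in N [:c:]"
  by (simp add: upoly_in_def coeff_pCons poly_ring_zero split: nat.splits)

lemma upoly_in_one: "upoly_in N 1"
  by (simp add: one_pCons upoly_in_const poly_ring_one)

lemma upoly_in_mult: "upoly_in N A \<Longrightarrow> upoly_in N B \<Longrightarrow> upoly_in N (A * B)"
  unfolding upoly_in_def coeff_mult by (intro allI poly_ring_sum poly_ring_mult) auto

lemma upoly_in_smult: "c \<in> poly_ring N \<Longrightarrow> upoly_in N A \<Longrightarrow> upoly_in N (smult c A)"
  by (simp add: upoly_in_def poly_ring_mult)

lemma upoly_in_monom: "c \<in> poly_ring N \<Longrightarrow> upoly_in N (monom c d)"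
  by (simp add: upoly_in_def poly_ring_zero)

lemma upoly_in_to_upoly: "p \<in> poly_ring (Suc N) \<Longrightarrow> upoly_in N (to_upoly p)"
  by (simp add: upoly_in_def coeff_to_upoly_poly_ring)

lemma upoly_in_iff_of_upoly: "upoly_in N P \<longleftrightarrow> of_upoly P \<in> poly_ring (Suc N)"
proof
  assume "upoly_in N P" then show "of_upoly P \<in> poly_ring (Suc N)"
    unfolding upoly_in_def by (intro of_upoly_poly_ring) auto
next
  assume "of_upoly P \<in> poly_ring (Suc N)"
  then have "upoly_in N (to_upoly (of_upoly P))" by (rule upoly_in_to_upoly)
  then show "upoly_in N P" by simp
qed

lemma upoly_in_factor:
  assumes "upoly_in N X" "X \<noteq> 0" "X = Y * Z"
  shows "upoly_in N Y"
proof -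
  have "of_upoly X = of_upoly Y * of_upoly Z" using assms(3) by (simp add: of_upoly_mult)
  moreover have "of_upoly X \<noteq> 0" using assms(2) to_upoly_of_upoly[of X] by (metis to_upoly_zero)
  moreover have "of_upoly X \<in> poly_ring (Suc N)" using assms(1) upoly_in_iff_of_upoly by blast
  ultimately have "of_upoly Y \<in> poly_ring (Suc N)" using poly_ring_factor by metis
  then show ?thesis using upoly_in_iff_of_upoly by blast
qed

lemma lead_coeff_upoly_in: "upoly_in N A \<Longrightarrow> lead_coeff A \<in> poly_ring N"
  by (simp add: upoly_in_def)

(* Primality relative to the subring poly_ring N; irreducibles get it by induction on N (Gauss' lemma). *)
definition prime_in :: "nat \<Rightarrow> 'a::field mpoly \<Rightarrow> bool" where
  "prime_in N c \<longleftrightarrow> (\<forall>a\<in>poly_ring N. \<forall>b\<in>poly_ring N. c dvd a * b \<longrightarrow> c dvd a \<or> c dvd b)"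

lemma prime_in_dvd_coeffs_mult:
  fixes c :: "'a::field mpoly"
  assumes rp: "prime_in N c" and RA: "upoly_in N a" and RB: "upoly_in N b"
    and dvd: "\<And>n. c dvd coeff (a * b) n"
    and coeff_m: "\<not> c dvd coeff b m" and dvd_b: "\<And>i. m < i \<Longrightarrow> c dvd coeff b i"
  shows "c dvd coeff a i"
proof (induction i rule: nat_descend_induct[of "degree a"])
  case (base i)
  then show ?case by (simp add: coeff_eq_0)
next
  case (descend i)
  \<comment> \<open>In the coefficient of x^(i+m) of a*b, every term other than coeff a i * coeff b m is divisible by c.\<close>
  let ?A = "{..i+m} - {i}"
  have "c dvd coeff (a * b) (i + m)" by (rule dvd)
  also have "coeff (a * b) (i + m) = (\<Sum>k\<le>i + m. coeff a k * coeff b (i + m - k))"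
    by (simp add: coeff_mult)
  also have "{..i+m} = insert i ?A" by auto
  also have "(\<Sum>k\<in>\<dots>. coeff a k * coeff b (i + m - k)) =
               coeff a i * coeff b m + (\<Sum>k\<in>?A. coeff a k * coeff b (i + m - k))"
    (is "_ = _ + ?S")
    by (subst sum.insert) simp_all
  finally have "c dvd coeff a i * coeff b m + ?S" .
  moreover have "c dvd ?S"
  proof (rule dvd_sum)
    fix k assume k: "k \<in> {..i+m} - {i}"
    show "c dvd coeff a k * coeff b (i + m - k)"
    proof (cases "k < i")
      case False
      with k have "c dvd coeff a k" by (intro descend.IH) simp
      then show ?thesis by simp
    next
      case True
      then have "c dvd coeff b (i + m - k)" by (intro dvd_b) simp
      then show ?thesis by simp
    qed
  qed
  ultimately have "c dvd coeff a i * coeff b m"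
    by (simp add: dvd_add_left_iff)
  moreover have "coeff a i \<in> poly_ring N" "coeff b m \<in> poly_ring N"
    using RA RB by (auto simp: upoly_in_def)
  ultimately show "c dvd coeff a i" using rp coeff_m unfolding prime_in_def by blast
qed

lemma const_poly_prime_in:
  fixes c :: "'a::field mpoly"
  assumes rp: "prime_in N c" and RA: "upoly_in N a" and RB: "upoly_in N b" and dv: "[:c:] dvd a * b"
  shows "[:c:] dvd a \<or> [:c:] dvd b"
proof (rule disjCI)
  assume "\<not> [:c:] dvd b"
  then have ex: "\<exists>i. \<not> c dvd coeff b i" by (subst (asm) const_poly_dvd_iff) blast
  have bound: "\<And>i. \<not> c dvd coeff b i \<Longrightarrow> i \<le> degree b"
    by (auto intro: le_degree)
  define m where "m = (GREATEST m. \<not> c dvd coeff b m)"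
  have coeff_m: "\<not> c dvd coeff b m" unfolding m_def by (rule GreatestI_ex_nat[OF ex bound])
  have "i \<le> m" if "\<not> c dvd coeff b i" for i
    unfolding m_def by (metis (mono_tags, lifting) bound Greatest_le_nat that)
  then have dvd_b: "c dvd coeff b i" if "m < i" for i
    using that by force
  have dvd: "c dvd coeff (a * b) n" for n
    using dv by (subst (asm) const_poly_dvd_iff) blast
  have "c dvd coeff a i" for i
    by (rule prime_in_dvd_coeffs_mult[OF rp RA RB dvd coeff_m dvd_b])
  then show "[:c:] dvd a" by (subst const_poly_dvd_iff) blast
qed

lemma pseudo_divide_upoly_in:
  fixes g :: "'a::field mpoly poly"
  assumes RG: "upoly_in N g" and g0: "g \<noteq> 0"
  shows "upoly_in N A \<Longrightarrow> \<exists>k Q r. upoly_in N Q \<and> upoly_in N r \<and> smult (lead_coeff g ^ k) A = Q * g + r \<and> (r = 0 \<or> degree r < degree g)"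
proof (induction A rule: measure_induct_rule[where f=degree])
  case (less A)
  show ?case
  proof (cases "A = 0 \<or> degree A < degree g")
    case True
    then show ?thesis
      by (intro exI[of _ 0] exI[of _ 0] exI[of _ A]) (auto simp: upoly_in_zero less.prems)
  next
    case False
    then have "A \<noteq> 0" "degree g \<le> degree A" by auto
    define d where "d = degree A - degree g"
    define A' where "A' = smult (lead_coeff g) A - monom (lead_coeff A) d * g"
    have RA': "upoly_in N A'" unfolding A'_def
      by (intro upoly_in_diff upoly_in_smult upoly_in_mult upoly_in_monom lead_coeff_upoly_in less.prems RG)
    have cA': "coeff A' (degree A) = 0"
      using \<open>degree g \<le> degree A\<close> by (simp add: A'_def coeff_monom_mult d_def)
    have dA': "degree A' \<le> degree A"
    proof -
      have "degree (smult (lead_coeff g) A) \<le> degree A" by (rule degree_smult_le)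
      moreover have "degree (monom (lead_coeff A) d * g) \<le> degree A"
        using degree_mult_le[of "monom (lead_coeff A) d" g] degree_monom_le[of "lead_coeff A" d]
          \<open>degree g \<le> degree A\<close> unfolding d_def by linarith
      ultimately show ?thesis unfolding A'_def by (rule degree_diff_le)
    qed
    show ?thesis
    proof (cases "A' = 0")
      case True
      then have "smult (lead_coeff g ^ 1) A = monom (lead_coeff A) d * g + 0" by (simp add: A'_def)
      then show ?thesis
        by (intro exI[of _ 1] exI[of _ "monom (lead_coeff A) d"] exI[of _ 0])
          (simp add: upoly_in_zero upoly_in_monom lead_coeff_upoly_in less.prems)
    next
      case False
      then have "degree A' \<noteq> degree A" using cA' by (metis leading_coeff_0_iff)
      then have "degree A' < degree A" using dA' by simp
      then obtain k Q r where Q: "upoly_in N Q" "upoly_in N r" "smult (lead_coeff g ^ k) A' = Q * g + r"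
          "r = 0 \<or> degree r < degree g"
        using less.IH[of A'] RA' by blast
      have "smult (lead_coeff g ^ Suc k) A = smult (lead_coeff g ^ k) A' +
              smult (lead_coeff g ^ k) (monom (lead_coeff A) d) * g"
        by (simp add: A'_def smult_diff_right smult_smult algebra_simps)
      also have "\<dots> = (Q + smult (lead_coeff g ^ k) (monom (lead_coeff A) d)) * g + r"
        using Q(3) by (simp add: algebra_simps)
      finally show ?thesis using Q
        by (intro exI[of _ "Suc k"] exI[of _ "Q + smult (lead_coeff g ^ k) (monom (lead_coeff A) d)"] exI[of _ r])
          (auto intro!: upoly_in_add upoly_in_smult upoly_in_monom poly_ring_power lead_coeff_upoly_in RG less.prems)
    qed
  qed
qed

lemma upoly_dvd_const_mult_cancel:
  fixes H :: "'a::field mpoly poly"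
  assumes irr_prime: "\<forall>q::'a mpoly\<in>poly_ring N. irreducible q \<longrightarrow> prime_in N q"
    and RH: "upoly_in N H" and nc: "\<forall>q\<in>poly_ring N. irreducible q \<longrightarrow> \<not> [:q:] dvd H"
  shows "c \<in> poly_ring N \<Longrightarrow> c \<noteq> 0 \<Longrightarrow> upoly_in N A \<Longrightarrow> H dvd [:c:] * A \<Longrightarrow> H dvd A"
proof (induction c rule: measure_induct_rule[where f=total_degree])
  case (less c)
  show ?case
  proof (cases "c dvd 1")
    case True
    then obtain u where u: "1 = c * u" by (rule dvdE)
    have cu: "c * u = 1" "u * c = 1" using u by (simp_all add: mult.commute)
    have "A = [:u:] * ([:c:] * A)" by (simp add: cu)
    moreover have "H dvd [:u:] * ([:c:] * A)" using less.prems(4) by (rule dvd_mult)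
    ultimately show ?thesis by simp
  next
    case False
    \<comment> \<open>Split off an irreducible q of c: [:q:] is prime by Gauss' lemma and does not divide H.\<close>
    obtain q where q: "irreducible q" "q dvd c"
      using mpoly_irreducible_divisor[of c] less.prems False by blast
    from q(2) obtain c' where c': "c = q * c'" by (rule dvdE)
    have qR: "q \<in> poly_ring N" using poly_ring_factor[of q c' N] c' less.prems by simp
    have c'R: "c' \<in> poly_ring N" using poly_ring_factor[of c' q N] c' less.prems by (simp add: mult.commute)
    have "c' \<noteq> 0" using c' less.prems by auto
    have "q \<noteq> 0" using q by auto
    have rp: "prime_in N q" using irr_prime qR q(1) by blast
    from less.prems(4) obtain W where W: "[:c:] * A = H * W" by (rule dvdE)
    show ?thesis
    proof (cases "A = 0")
      case True then show ?thesis by simp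
    next
      case False
      have X0: "[:c:] * A \<noteq> 0" using False less.prems by simp
      have "upoly_in N ([:c:] * A)" by (intro upoly_in_mult upoly_in_const less.prems)
      then have RW: "upoly_in N W" using X0 W by (intro upoly_in_factor[of N "[:c:] * A" W H]) (auto simp: mult.commute)
      have cq: "[:c:] = [:q:] * [:c':]" using c' by simp
      have E: "H * W = [:q:] * ([:c':] * A)" by (simp only: W[symmetric] cq mult.assoc)
      have "[:q:] dvd H * W" unfolding E by (rule dvd_triv_left)
      then have "[:q:] dvd H \<or> [:q:] dvd W" by (rule const_poly_prime_in[OF rp RH RW])
      moreover have "\<not> [:q:] dvd H" using nc q qR by blast
      ultimately have "[:q:] dvd W" by blast
      then obtain W' where W': "W = [:q:] * W'" by (rule dvdE)
      have "[:q:] * ([:c':] * A) = [:q:] * (H * W')"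
        using W unfolding cq W' by (simp add: ac_simps)
      moreover have nz: "[:q:] \<noteq> 0" using \<open>q \<noteq> 0\<close> by simp
      ultimately have "[:c':] * A = H * W'" by (rule mult_left_cancel[THEN iffD1, rotated])
      then have "H dvd [:c':] * A" by (rule dvdI)
      moreover have "total_degree c' < total_degree c" using total_degree_less_mult[of q c'] c' less.prems q irreducible_not_unit by blast
      ultimately show ?thesis using less.IH[of c'] c'R \<open>c' \<noteq> 0\<close> less.prems(3) by blast
    qed
  qed
qed

(* A nonzero element of least degree in the span of P and A: pseudo-dividing any element of the span
   by it leaves a remainder in the span of smaller degree, hence zero. *)
lemma upoly_in_pseudo_gcd:
  fixes P A :: "'a::field mpoly poly"
  assumes RP: "upoly_in N P" and RA: "upoly_in N A" and P0: "P \<noteq> 0"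
  obtains G U V c d where "G = U * P + V * A" "upoly_in N U" "upoly_in N V" "G \<noteq> 0"
    "c \<in> poly_ring N" "c \<noteq> 0" "G dvd [:c:] * P" "d \<in> poly_ring N" "d \<noteq> 0" "G dvd [:d:] * A"
proof -
  define M where "M = {U * P + V * A | U V. upoly_in N U \<and> upoly_in N V}"
  have RM: "upoly_in N G" if "G \<in> M" for G
    using that unfolding M_def by (auto intro!: upoly_in_add upoly_in_mult RP RA)
  have PM: "P \<in> M" unfolding M_def
    by (rule CollectI, rule exI[of _ 1], rule exI[of _ 0]) (simp add: upoly_in_one upoly_in_zero)
  have AM: "A \<in> M" unfolding M_def
    by (rule CollectI, rule exI[of _ 0], rule exI[of _ 1]) (simp add: upoly_in_one upoly_in_zero)
  define d0 where "d0 = (LEAST d. \<exists>G\<in>M. G \<noteq> 0 \<and> degree G = d)"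
  have ex: "\<exists>d. \<exists>G\<in>M. G \<noteq> 0 \<and> degree G = d" using PM P0 by blast
  obtain G0 where G0: "G0 \<in> M" "G0 \<noteq> 0" "degree G0 = d0"
    using LeastI_ex[of "\<lambda>d. \<exists>G\<in>M. G \<noteq> 0 \<and> degree G = d", OF ex]
    unfolding d0_def by blast
  have minG: "d0 \<le> degree G" if "G \<in> M" "G \<noteq> 0" for G
    unfolding d0_def by (rule Least_le) (use that in blast)
  obtain U0 V0 where UV: "G0 = U0 * P + V0 * A" "upoly_in N U0" "upoly_in N V0"
    using G0(1) unfolding M_def by blast
  have RG0: "upoly_in N G0" using RM G0 by blast
  have lcR: "lead_coeff G0 ^ k \<in> poly_ring N" for k by (intro poly_ring_power lead_coeff_upoly_in RG0)
  have lc0: "lead_coeff G0 ^ k \<noteq> 0" for k using G0(2) by simp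
  have divides: "\<exists>k. G0 dvd [:lead_coeff G0 ^ k:] * X" if XM: "X \<in> M" for X
  proof -
    have "upoly_in N X" using RM XM by blast
    then obtain k Q r where Q: "upoly_in N Q" "upoly_in N r" "smult (lead_coeff G0 ^ k) X = Q * G0 + r"
        "r = 0 \<or> degree r < degree G0"
      using pseudo_divide_upoly_in[OF RG0 G0(2), of X] by blast
    obtain U V where X: "X = U * P + V * A" "upoly_in N U" "upoly_in N V" using XM unfolding M_def by blast
    have "r = smult (lead_coeff G0 ^ k) X - Q * G0" using Q(3) by simp
    also have "\<dots> = ([:lead_coeff G0 ^ k:] * U - Q * U0) * P + ([:lead_coeff G0 ^ k:] * V - Q * V0) * A"
      unfolding X(1) UV(1) by (simp add: algebra_simps smult_add_right)
    finally have req: "r = ([:lead_coeff G0 ^ k:] * U - Q * U0) * P + ([:lead_coeff G0 ^ k:] * V - Q * V0) * A" .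
    have "upoly_in N ([:lead_coeff G0 ^ k:] * U - Q * U0)" "upoly_in N ([:lead_coeff G0 ^ k:] * V - Q * V0)"
      by (intro upoly_in_diff upoly_in_mult upoly_in_const lcR X(2,3) UV(2,3) Q(1))+
    then have "r \<in> M" unfolding M_def using req by blast
    then have "r = 0" using Q(4) minG G0(3) by fastforce
    then have "[:lead_coeff G0 ^ k:] * X = G0 * Q" using Q(3) by (simp add: mult.commute)
    then show ?thesis by (intro exI[of _ k] dvdI)
  qed
  obtain kA where kA: "G0 dvd [:lead_coeff G0 ^ kA:] * A" using divides AM by blast
  obtain kP where kP: "G0 dvd [:lead_coeff G0 ^ kP:] * P" using divides PM by blast
  show thesis by (rule that[OF UV G0(2) lcR lc0 kP lcR lc0 kA])
qed

lemma irreducible_upoly_prime_in: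
  fixes P A B :: "'a::field mpoly poly"
  assumes irr_prime: "\<forall>q::'a mpoly\<in>poly_ring N. irreducible q \<longrightarrow> prime_in N q"
    and RP: "upoly_in N P" and RA: "upoly_in N A" and RB: "upoly_in N B"
    and irr: "irreducible P" and dv: "P dvd A * B"
  shows "P dvd A \<or> P dvd B"
proof (cases "degree P = 0")
  case True
  then obtain c where Pc: "P = [:c:]" by (rule degree_eq_zeroE)
  have "c \<in> poly_ring N" using RP Pc unfolding upoly_in_def by (metis coeff_pCons_0)
  have "irreducible c" using irr Pc irreducible_const_poly_iff by blast
  then have "prime_in N c" using irr_prime \<open>c \<in> poly_ring N\<close> by blast
  then show ?thesis using const_poly_prime_in[OF _ RA RB] dv Pc by blast
next
  case False
  have ncP: "\<forall>q\<in>poly_ring N. irreducible q \<longrightarrow> \<not> [:q:] dvd P"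
    using irreducible_not_const_dvd[OF irr] False irreducible_not_unit by blast
  obtain G U V c d where G: "G = U * P + V * A" "upoly_in N U" "upoly_in N V" "G \<noteq> 0"
      "c \<in> poly_ring N" "c \<noteq> 0" "G dvd [:c:] * P" "d \<in> poly_ring N" "d \<noteq> 0" "G dvd [:d:] * A"
    using upoly_in_pseudo_gcd[OF RP RA] irr by (metis not_irreducible_zero)
  have RG: "upoly_in N G" unfolding G(1) by (intro upoly_in_add upoly_in_mult G(2,3) RP RA)
  show ?thesis
  proof (cases "degree G = 0")
    case True
    then obtain g where g: "G = [:g:]" by (rule degree_eq_zeroE)
    have "g \<in> poly_ring N" using RG g unfolding upoly_in_def by (metis coeff_pCons_0)
    have "g \<noteq> 0" using G(4) g by simp
    have "[:g:] * B = U * (P * B) + V * (A * B)" using G(1) g by (simp add: algebra_simps)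
    moreover have "P dvd V * (A * B)" using dv by (rule dvd_mult)
    ultimately have "P dvd [:g:] * B" by simp
    then show ?thesis
      using upoly_dvd_const_mult_cancel[OF irr_prime RP ncP \<open>g \<in> poly_ring N\<close> \<open>g \<noteq> 0\<close> RB] by blast
  next
    case False
    \<comment> \<open>An irreducible factor h of G of positive degree divides c P, hence P, hence is associated to P.\<close>
    obtain h where h: "irreducible h" "degree h > 0" "h dvd G"
      using upoly_irreducible_divisor[of G] False by auto
    obtain w where "G = h * w" using h(3) by (rule dvdE)
    then have Rh: "upoly_in N h" using upoly_in_factor[OF RG G(4)] by blast
    have nch: "\<forall>q\<in>poly_ring N. irreducible q \<longrightarrow> \<not> [:q:] dvd h"
      using irreducible_not_const_dvd[OF h(1,2)] irreducible_not_unit by blast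
    have "h dvd [:c:] * P" using h(3) G(7) by (rule dvd_trans)
    then have "h dvd P" using upoly_dvd_const_mult_cancel[OF irr_prime Rh nch G(5,6) RP] by blast
    then have "P dvd h"
      using irreducible_dvd_nonunit_imp_dvd[OF irr] h(1) irreducible_not_unit by blast
    then have "P dvd [:d:] * A" using h(3) G(10) dvd_trans by blast
    then show ?thesis using upoly_dvd_const_mult_cancel[OF irr_prime RP ncP G(8,9) RA] by blast
  qed
qed

lemma irreducible_prime_in_Suc:
  assumes irr_prime: "\<forall>q::'a::field mpoly\<in>poly_ring N. irreducible q \<longrightarrow> prime_in N q"
  shows "\<forall>q\<in>poly_ring (Suc N). irreducible (q::'a mpoly) \<longrightarrow> prime_in (Suc N) q"
proof (intro ballI impI)
  fix p :: "'a mpoly" assume p: "p \<in> poly_ring (Suc N)" "irreducible p"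
  show "prime_in (Suc N) p" unfolding prime_in_def
  proof (intro ballI impI)
    fix a b assume a: "a \<in> poly_ring (Suc N)" and b: "b \<in> poly_ring (Suc N)" and dv: "p dvd a * b"
    have irrP: "irreducible (to_upoly p)" using p(2) to_upoly_irreducible_iff by blast
    have dvP: "to_upoly p dvd to_upoly a * to_upoly b" using dv by (simp add: to_upoly_mult[symmetric] to_upoly_dvd_iff)
    have "to_upoly p dvd to_upoly a \<or> to_upoly p dvd to_upoly b"
      by (rule irreducible_upoly_prime_in[OF irr_prime upoly_in_to_upoly[OF p(1)] upoly_in_to_upoly[OF a] upoly_in_to_upoly[OF b] irrP dvP])
    then show "p dvd a \<or> p dvd b" by (simp add: to_upoly_dvd_iff)
  qed
qed

lemma irreducible_prime_in_0: "\<forall>q\<in>poly_ring 0. irreducible (q::'a::field mpoly) \<longrightarrow> prime_in 0 q"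
proof (intro ballI impI)
  fix q :: "'a mpoly" assume q: "q \<in> poly_ring 0" "irreducible q"
  have "Poly_Mapping.keys q \<subseteq> {0}"
  proof
    fix t assume "t \<in> Poly_Mapping.keys q"
    then have "Poly_Mapping.keys t = {}" using q(1) unfolding poly_ring_iff by blast
    then show "t \<in> {0}" by simp
  qed
  then have "total_degree q = 0" by (auto simp: weighted_degree_eq_0_iff monom_degree_def)
  moreover have "q \<noteq> 0" using q by auto
  ultimately have "q dvd 1" using mpoly_is_unit_iff by blast
  then show "prime_in 0 q" using q(2) irreducible_not_unit by blast
qed

lemma irreducible_prime_in: "\<forall>q\<in>poly_ring N. irreducible (q::'a::field mpoly) \<longrightarrow> prime_in N q"
  by (induction N) (simp_all add: irreducible_prime_in_0 irreducible_prime_in_Suc)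

theorem mpoly_irreducible_imp_prime_elem:
  fixes q :: "'a::field mpoly"
  assumes "irreducible q"
  shows "prime_elem q"
proof (rule prime_elemI)
  show "q \<noteq> 0" "\<not> q dvd 1" using assms by (auto dest: irreducible_not_unit)
  fix a b assume dv: "q dvd a * b"
  obtain n1 n2 n3 where "q \<in> poly_ring n1" "a \<in> poly_ring n2" "b \<in> poly_ring n3"
    using poly_ring_exists by metis
  then have "q \<in> poly_ring (max n1 (max n2 n3))" "a \<in> poly_ring (max n1 (max n2 n3))"
    "b \<in> poly_ring (max n1 (max n2 n3))" by (auto elim!: poly_ring_mono)
  then show "q dvd a \<or> q dvd b" using irreducible_prime_in assms dv unfolding prime_in_def by blast
qed

section \<open>Pairwise coprime elements of the ideal\<close>

(* The library's coprime requires algebraic_semidom, and mpoly has no division operation. *)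
definition coprime_elem :: "'a::comm_semiring_1 \<Rightarrow> 'a \<Rightarrow> bool" where
  "coprime_elem a b \<longleftrightarrow> (\<forall>c. c dvd a \<longrightarrow> c dvd b \<longrightarrow> c dvd 1)"

lemma coprime_elemI: "(\<And>c. c dvd a \<Longrightarrow> c dvd b \<Longrightarrow> c dvd 1) \<Longrightarrow> coprime_elem a b"
  unfolding coprime_elem_def by blast

lemma coprime_elem_common_divisor: "coprime_elem a b \<Longrightarrow> c dvd a \<Longrightarrow> c dvd b \<Longrightarrow> c dvd 1"
  unfolding coprime_elem_def by blast

lemma coprime_elem_dvd_right: "coprime_elem a b \<Longrightarrow> c dvd b \<Longrightarrow> coprime_elem a c"
  unfolding coprime_elem_def by (blast intro: dvd_trans)

lemma mpoly_coprime_elemI: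
  fixes a b :: "'a::field mpoly"
  assumes "a \<noteq> 0" and "\<And>q. irreducible q \<Longrightarrow> q dvd a \<Longrightarrow> q dvd b \<Longrightarrow> False"
  shows "coprime_elem a b"
proof (rule coprime_elemI, rule ccontr)
  fix c assume c: "c dvd a" "c dvd b" "\<not> c dvd 1"
  have "c \<noteq> 0" using c(1) assms(1) by auto
  then obtain q where "irreducible q" "q dvd c" using mpoly_irreducible_divisor c(3) by blast
  then show False using assms(2) dvd_trans[OF _ c(1)] dvd_trans[OF _ c(2)] by blast
qed

lemma mpoly_coprime_mult_irreducible:
  fixes h q x :: "'a::field mpoly"
  assumes "irreducible q" "\<not> q dvd h" "coprime_elem h x"
  shows "coprime_elem h (q * x)"
proof (rule mpoly_coprime_elemI)
  show "h \<noteq> 0" using assms(2) by auto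
  fix r assume r: "irreducible r" "r dvd h" "r dvd q * x"
  have "r dvd q \<or> r dvd x"
    using r mpoly_irreducible_imp_prime_elem prime_elem_dvd_multD by blast
  then show False
  proof
    assume "r dvd q"
    then have "q dvd r"
      by (rule irreducible_dvd_nonunit_imp_dvd[OF assms(1) _ irreducible_not_unit[OF r(1)]])
    then show False using assms(2) r(2) dvd_trans by blast
  next
    assume "r dvd x"
    then show False using assms(3) r(1,2) coprime_elem_common_divisor irreducible_not_unit by metis
  qed
qed

lemma dvd_in_imp_dvd: "dvd_in n d f \<Longrightarrow> d dvd f"
  unfolding dvd_in_def by (auto simp: dvd_def)

lemma dvd_imp_dvd_in:
  fixes d f :: "'a::field mpoly"
  assumes "f \<in> poly_ring n" "d dvd f"
  shows "dvd_in n d f"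
proof (cases "f = 0")
  case True then show ?thesis unfolding dvd_in_def using poly_ring_zero by force
next
  case False
  obtain q where q: "f = d * q" using assms(2) by (rule dvdE)
  then have "q \<in> poly_ring n" using poly_ring_factor[of q d n] assms(1) False by (simp add: mult.commute)
  then show ?thesis unfolding dvd_in_def using q by blast
qed

lemma unit_in_iff: "unit_in n (d::'a::field mpoly) \<longleftrightarrow> d dvd 1"
  unfolding unit_in_def using dvd_in_imp_dvd dvd_imp_dvd_in[OF poly_ring_one] by metis

lemma gcd_one_in_pairI:
  fixes a b :: "'a::field mpoly"
  assumes "coprime_elem a b"
  shows "gcd_one_in n {a, b}"
  unfolding gcd_one_in_def unit_in_iff
  using assms coprime_elem_common_divisor dvd_in_imp_dvd by (metis insert_iff)

lemma sequence_by_extension: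
  assumes "\<And>xs. set xs \<subseteq> S \<Longrightarrow> \<exists>x\<in>S. \<forall>y\<in>set xs. R x y"
  shows "\<exists>h :: nat \<Rightarrow> 'a. (\<forall>i. h i \<in> S) \<and> (\<forall>i j. j < i \<longrightarrow> R (h i) (h j))"
proof -
  define ext where "ext xs = (SOME x. x \<in> S \<and> (\<forall>y\<in>set xs. R x y))" for xs
  define prefix where "prefix k = ((\<lambda>xs. xs @ [ext xs]) ^^ k) []" for k
  define h where "h i = ext (prefix i)" for i
  have prefix_eq: "prefix k = map h [0..<k]" for k
  proof (induction k)
    case (Suc k)
    have "prefix (Suc k) = prefix k @ [h k]" by (simp add: prefix_def h_def)
    with Suc show ?case by simp
  qed (simp add: prefix_def)
  have ext_ok: "ext xs \<in> S \<and> (\<forall>y\<in>set xs. R (ext xs) y)" if xs: "set xs \<subseteq> S" for xs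
  proof -
    obtain x where "x \<in> S \<and> (\<forall>y\<in>set xs. R x y)" using assms[OF xs] by blast
    then show ?thesis unfolding ext_def by (rule someI)
  qed
  have "h i \<in> S \<and> (\<forall>j<i. R (h i) (h j))" for i
  proof (induction i rule: less_induct)
    case (less i)
    have "set (prefix i) \<subseteq> S" using less by (auto simp: prefix_eq)
    then have "h i \<in> S \<and> (\<forall>y\<in>set (prefix i). R (h i) y)"
      unfolding h_def[of i] by (rule ext_ok)
    moreover have "h j \<in> set (prefix i)" if "j < i" for j
      using that by (simp add: prefix_eq)
    ultimately show ?case by blast
  qed
  then show ?thesis by blast
qed

context
  fixes f :: "nat \<Rightarrow> ('a::field) mpoly" and n m :: nat
  assumes generators_poly_ring: "\<forall>i<m. f i \<in> poly_ring n"
    and generators_gcd_one: "gcd_one_in n (f ` {..<m})"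
begin

lemma ideal_gen_poly_ring: "h \<in> ideal_gen n m f \<Longrightarrow> h \<in> poly_ring n"
  unfolding ideal_gen_def using generators_poly_ring
  by (auto intro!: poly_ring_sum poly_ring_mult)

lemma ideal_gen_add_mult:
  assumes "h \<in> ideal_gen n m f" "c \<in> poly_ring n" "k < m"
  shows "h + c * f k \<in> ideal_gen n m f"
proof -
  obtain g where g: "h = (\<Sum>i<m. g i * f i)" "\<forall>i<m. g i \<in> poly_ring n"
    using assms(1) unfolding ideal_gen_def by blast
  define g' where "g' i = g i + (if i = k then c else 0)" for i
  have "(\<Sum>i<m. g' i * f i) = (\<Sum>i<m. g i * f i + (if i = k then c * f i else 0))"
    by (rule sum.cong) (simp_all add: g'_def distrib_right)
  also have "\<dots> = (\<Sum>i<m. g i * f i) + (\<Sum>i<m. if i = k then c * f i else 0)"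
    by (rule sum.distrib)
  also have "\<dots> = h + c * f k"
    using assms(3) g(1) by simp
  finally show ?thesis
    using g(2) assms(2) unfolding ideal_gen_def
    by (auto simp: g'_def intro!: exI[of _ g'] poly_ring_add poly_ring_zero)
qed

lemma generator_in_ideal_gen: "k < m \<Longrightarrow> f k \<in> ideal_gen n m f"
  using ideal_gen_add_mult[of 0 1 k] poly_ring_one
  unfolding ideal_gen_def by (force intro: poly_ring_zero)

lemma generator_nonzero: "\<exists>k<m. f k \<noteq> 0"
proof (rule ccontr)
  assume "\<not> (\<exists>k<m. f k \<noteq> 0)"
  then have "\<forall>x\<in>f ` {..<m}. dvd_in n 0 x"
    unfolding dvd_in_def using poly_ring_zero by auto
  then have "unit_in n (0::'a mpoly)"
    using generators_gcd_one poly_ring_zero unfolding gcd_one_in_def by blast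
  then show False by (simp add: unit_in_iff)
qed

lemma generators_not_all_dvd:
  assumes "irreducible q"
  shows "\<exists>k<m. \<not> q dvd f k"
proof (rule ccontr)
  assume "\<not> (\<exists>k<m. \<not> q dvd f k)"
  then have dvd_all: "\<forall>k<m. q dvd f k" by blast
  obtain k where k: "k < m" "f k \<noteq> 0" using generator_nonzero by blast
  then obtain w where "f k = q * w" using dvd_all by (meson dvdE)
  then have "q \<in> poly_ring n" using k generators_poly_ring poly_ring_factor by metis
  moreover have "\<forall>x\<in>f ` {..<m}. dvd_in n q x"
    using dvd_all generators_poly_ring dvd_imp_dvd_in by blast
  ultimately have "unit_in n q"
    using generators_gcd_one unfolding gcd_one_in_def by blast
  then show False using assms irreducible_not_unit unit_in_iff by blast
qed

lemma ideal_gen_coprime_element: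
  "x \<in> poly_ring n \<Longrightarrow> x \<noteq> 0 \<Longrightarrow> \<exists>h\<in>ideal_gen n m f. h \<noteq> 0 \<and> coprime_elem h x"
proof (induction x rule: measure_induct_rule[where f = total_degree])
  case (less x)
  show ?case
  proof (cases "x dvd 1")
    case True
    obtain k where "k < m" "f k \<noteq> 0" using generator_nonzero by blast
    moreover have "coprime_elem (f k) x"
      using True by (auto intro: coprime_elemI dvd_trans)
    ultimately show ?thesis using generator_in_ideal_gen by blast
  next
    case False
    obtain q where q: "irreducible q" "q dvd x"
      using mpoly_irreducible_divisor less.prems False by blast
    from q(2) obtain x' where x': "x = q * x'" by (rule dvdE)
    have "x' \<in> poly_ring n" "x' \<noteq> 0"
      using poly_ring_factor[of x' q n] x' less.prems by (auto simp: mult.commute)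
    moreover have "total_degree x' < total_degree x"
      using total_degree_less_mult[of q x'] x' less.prems q irreducible_not_unit by blast
    ultimately obtain h' where h': "h' \<in> ideal_gen n m f" "coprime_elem h' x'"
      using less.IH by blast
    \<comment> \<open>If q divides h', adding a multiple of x' that q does not divide repairs this.\<close>
    obtain h where h: "h \<in> ideal_gen n m f" "\<not> q dvd h" "coprime_elem h x'"
    proof (cases "q dvd h'")
      case True
      obtain k where k: "k < m" "\<not> q dvd f k" using generators_not_all_dvd q(1) by blast
      have "\<not> q dvd h' + x' * f k"
      proof
        assume "q dvd h' + x' * f k"
        then have "q dvd x' * f k" using True by (simp add: dvd_add_right_iff)
        then have "q dvd x'"
          using k(2) q(1) mpoly_irreducible_imp_prime_elem prime_elem_dvd_multD by blast
        then show False
          using True h'(2) q(1) coprime_elem_common_divisor irreducible_not_unit by blast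
      qed
      moreover have "coprime_elem (h' + x' * f k) x'"
        using h'(2) by (auto intro!: coprime_elemI dest: coprime_elem_common_divisor
            simp: dvd_add_left_iff)
      ultimately show thesis
        using that ideal_gen_add_mult[OF h'(1) \<open>x' \<in> poly_ring n\<close> k(1)] by blast
    qed (use h' in blast)
    have "h \<noteq> 0" using h(2) by auto
    then show ?thesis
      using h mpoly_coprime_mult_irreducible[OF q(1) h(2,3)] x' by blast
  qed
qed

end

theorem lemma3p4:
  fixes f :: "nat \<Rightarrow> ('a::field) mpoly" and n m :: nat
  assumes "m \<ge> 2"
    and "\<forall>i<m. f i \<in> poly_ring n"
    and "gcd_one_in n (f ` {..<m})"
  shows "\<exists>h :: nat \<Rightarrow> 'a mpoly. (\<forall>i. h i \<in> ideal_gen n m f) \<and>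
           (\<forall>i j. i \<noteq> j \<longrightarrow> gcd_one_in n {h i, h j})"
proof -
  let ?S = "{h \<in> ideal_gen n m f. h \<noteq> 0}"
  have extend: "\<exists>h\<in>?S. \<forall>y\<in>set ys. coprime_elem h y" if "set ys \<subseteq> ?S" for ys
  proof -
    have "prod_list ys \<in> poly_ring n" "prod_list ys \<noteq> 0"
      using that ideal_gen_poly_ring[OF assms(2,3)]
      by (auto intro!: poly_ring_prod_list simp: prod_list_zero_iff)
    then obtain h where "h \<in> ?S" "coprime_elem h (prod_list ys)"
      using ideal_gen_coprime_element[OF assms(2,3)] by blast
    then show ?thesis using coprime_elem_dvd_right prod_list_dvd by blast
  qed
  obtain h :: "nat \<Rightarrow> 'a mpoly" where
    h: "\<forall>i. h i \<in> ?S" "\<forall>i j. j < i \<longrightarrow> coprime_elem (h i) (h j)"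
    using sequence_by_extension[of ?S coprime_elem, OF extend] by blast
  have "gcd_one_in n {h i, h j}" if "i \<noteq> j" for i j
  proof (cases "j < i")
    case True
    then show ?thesis using h(2) gcd_one_in_pairI by blast
  next
    case False
    then have "i < j" using that by simp
    then have "gcd_one_in n {h j, h i}" using h(2) gcd_one_in_pairI by blast
    then show ?thesis by (simp add: insert_commute)
  qed
  then show ?thesis using h(1) by (intro exI[of _ h]) blast
qed

end
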